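(* Let $f\in C((0,\infty);(0,\infty))$ be increasing and locally Lipschitz continuous, with $x\mapsto f(x)/x$ ultimately increasing and $\lim_{x\to\infty} f(x)/x=\infty$. Let $F(x)=\int_1^x \frac{du}{f(u)}$ for $x\ge 1$, and suppose $\lim_{x\to\infty}F(x)=\infty$. Let $h\in C((0,\infty);\mathbb{R})$ with $H(t)=\int_0^t h(s)\,ds\ge 0$ for each $t\ge 0$. Let $\psi>0$ and let $x$ be the unique continuous solution of $$x'(t)=f(x(t))+h(t),\quad t\ge 0;\qquad x(0)=\psi.$$ Then the following are equivalent: (i) $\limsup_{t\to\infty}\dfrac{F(H(t))}{t}\in[0,1]$; (ii) $\lim_{t\to\infty}\dfrac{F(x(t))}{t}=1$.
   Context: "Ultimately increasing" means increasing on $[x_0,\infty)$ for some $x_0>0$. The condition $\lim_{x\to\infty}F(x)=\infty$ ensures that the solution $x$ is defined on all of $[0,\infty)$, and local Lipschitz continuity of $f$ ensures that it is unique. *)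

theory Defs
  imports "HOL-Analysis.Analysis"
begin

definition ultimately_increasing :: "(real \<Rightarrow> real) \<Rightarrow> bool" where
  "ultimately_increasing g \<longleftrightarrow> (\<exists>x0>0. mono_on {x0..} g)"

text \<open>
  The function \<open>F\<close> is only meaningful on \<open>[1,\<infinity>)\<close>. For \<open>x < 1\<close> the interval \<open>{1..x}\<close> is empty, so that
  \<open>F_of f x = 0\<close> there: this is the extension \<open>F (max 1 x)\<close>, not the signed integral. The
  signed integral would not do in \<open>F (H t)\<close>, where \<open>H t\<close> may be \<open>0\<close> or arbitrarily
  close to \<open>0\<close> while \<open>1 / f\<close> need not be integrable at \<open>0\<close>.
\<close>

definition F_of :: "(real \<Rightarrow> real) \<Rightarrow> real \<Rightarrow> real" where
  "F_of f x = integral {1..x} (\<lambda>u. 1 / f u)"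

definition H_of :: "(real \<Rightarrow> real) \<Rightarrow> real \<Rightarrow> real" where
  "H_of h t = integral {0..t} h"

text \<open>
  The forcing term \<open>h\<close> is given on \<open>(0,\<infinity>)\<close> only, so the equation is required for \<open>t > 0\<close>;
  the initial value is attained by continuity of \<open>x\<close> on \<open>[0,\<infinity>)\<close>. If \<open>h\<close> is also continuous
  at \<open>0\<close>, the equation at \<open>t = 0\<close> (with the right derivative) follows.
  Positivity says that \<open>x\<close> stays in the domain of \<open>f\<close>.
\<close>

definition is_solution ::
  "(real \<Rightarrow> real) \<Rightarrow> (real \<Rightarrow> real) \<Rightarrow> real \<Rightarrow> (real \<Rightarrow> real) \<Rightarrow> bool" where
  "is_solution f h \<psi> x \<longleftrightarrow>
     continuous_on {0..} x \<and> (\<forall>t\<ge>0. x t > 0) \<and> x 0 = \<psi> \<and>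
     (\<forall>t>0. (x has_real_derivative (f (x t) + h t)) (at t))"

end

theory Submission
  imports Defs
begin

text \<open>
  Put \<open>y = x - H\<close>, so that \<open>y' = f x \<ge> f y\<close> and hence \<open>F x \<ge> F y \<ge> t - const\<close>; in particular the
  lower limit of \<open>F x / t\<close> is always at least \<open>1\<close>, and \<open>H \<le> x\<close> gives the easy implication.
  For the converse let \<open>z\<close> satisfy \<open>F z = (1 + \<epsilon>) t\<close>, so that eventually \<open>H \<le> z\<close>, and put
  \<open>w = y + z \<ge> x\<close>. Then \<open>w' \<le> f w + (1 + \<epsilon>) f z\<close>. For a large constant \<open>K\<close>, either \<open>w \<le> K z\<close>, and
  \<open>F w \<le> F (K z) \<le> F z + const\<close>; or \<open>w > K z\<close>, and monotonicity of \<open>f u / u\<close> gives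
  \<open>f z \<le> f w / K\<close>, so \<open>F w\<close> grows at rate at most \<open>1 + \<epsilon>\<close>. Hence \<open>F x \<le> F w \<le> (1 + \<epsilon>) t + const\<close>.
\<close>

section \<open>The function \<open>F\<close> and its inverse\<close>

lemma F_of_nonneg:
  fixes f :: "real \<Rightarrow> real"
  assumes "\<And>u. u > 0 \<Longrightarrow> f u > 0"
  shows "F_of f v \<ge> 0"
  unfolding F_of_def
proof (cases "(\<lambda>u. 1 / f u) integrable_on {1..v}")
  case True
  then show "integral {1..v} (\<lambda>u. 1 / f u) \<ge> 0"
    by (rule integral_nonneg) (use assms in \<open>auto intro!: less_imp_le\<close>)
\<comment> \<open>A non-integrable integrand has integral \<open>0\<close> by convention, so
  positivity of \<open>f\<close> suffices.\<close>
qed (simp add: not_integrable_integral)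

lemma recip_continuous_on:
  fixes f :: "real \<Rightarrow> real"
  assumes cont: "continuous_on {0<..} f" and pos: "\<And>u. u > 0 \<Longrightarrow> f u > 0"
  shows "continuous_on {1..b} (\<lambda>u. 1 / f u)"
proof (rule continuous_on_divide[OF continuous_on_const])
  show "continuous_on {1..b} f"
    by (rule continuous_on_subset[OF cont]) auto
  show "\<forall>u\<in>{1..b}. f u \<noteq> 0"
  proof
    fix u assume "u \<in> {1..b}"
    then show "f u \<noteq> 0" using pos[of u] by auto
  qed
qed

text \<open>The intervals \<open>{1..v}\<close> and \<open>{1..w}\<close> are nested, also when they
  are empty. Values below \<open>1\<close> are therefore allowed, as required for
  \<open>F (H t)\<close>.\<close>

lemma F_of_mono:
  fixes f :: "real \<Rightarrow> real"
  assumes cont: "continuous_on {0<..} f" and pos: "\<And>u. u > 0 \<Longrightarrow> f u > 0" and "v \<le> w"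
  shows "F_of f v \<le> F_of f w"
  unfolding F_of_def
proof (rule integral_subset_le)
  show "(\<lambda>u. 1 / f u) integrable_on {1..v}" "(\<lambda>u. 1 / f u) integrable_on {1..w}"
    using recip_continuous_on[OF cont pos] by (auto intro: integrable_continuous_real)
  show "\<forall>u\<in>{1..w}. 0 \<le> 1 / f u"
    using pos by (simp add: less_imp_le)
qed (use assms in auto)

text \<open>The strict bound \<open>v > 1\<close> matters: \<open>F\<close> vanishes to the left of
  \<open>1\<close>, so it has a kink at \<open>1\<close>.\<close>

lemma F_of_has_real_derivative:
  fixes f :: "real \<Rightarrow> real"
  assumes cont: "continuous_on {0<..} f" and pos: "\<And>u. u > 0 \<Longrightarrow> f u > 0" and "v > 1"
  shows "(F_of f has_real_derivative 1 / f v) (at v)"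
proof -
  have "((\<lambda>w. integral {1..w} (\<lambda>u. 1 / f u)) has_real_derivative 1 / f v) (at v within {1..v + 1})"
    by (rule integral_has_real_derivative[OF recip_continuous_on[OF cont pos]])
      (use \<open>v > 1\<close> in auto)
  moreover have "at v within {1..v + 1} = at v"
    by (rule at_within_interior) (use \<open>v > 1\<close> in auto)
  ultimately show ?thesis
    unfolding F_of_def[abs_def] by simp
qed

text \<open>\<open>G\<close> inverts \<open>F\<close> on the values above \<open>1\<close> and
  solves the unforced equation \<open>G' = f G\<close>; run at speed \<open>1 + \<epsilon>\<close>
  it later provides the comparison function \<open>z\<close>. Divergence of \<open>F\<close> makes
  \<open>G\<close> defined for every \<open>s > 0\<close>.\<close>

lemma F_of_inverse_exists:
  fixes f :: "real \<Rightarrow> real"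
  assumes cont: "continuous_on {0<..} f" and pos: "\<And>u. u > 0 \<Longrightarrow> f u > 0"
    and lim: "filterlim (F_of f) at_top at_top"
  obtains G where "\<And>s. s > 0 \<Longrightarrow> G s > 1" "\<And>s. s > 0 \<Longrightarrow> F_of f (G s) = s"
    "\<And>s. s > 0 \<Longrightarrow> (G has_real_derivative f (G s)) (at s)"
proof -
  have deriv: "(F_of f has_real_derivative 1 / f v) (at v)" if "v > 1" for v
    by (rule F_of_has_real_derivative[OF cont]) (use pos that in auto)
  have F1: "F_of f 1 = 0"
    by (simp add: F_of_def)
  have strict: "F_of f v < F_of f w" if "1 < v" "v < w" for v w
  proof (rule DERIV_pos_imp_increasing[OF \<open>v < w\<close>])
    fix u assume "v \<le> u" "u \<le> w"
    then show "\<exists>D. (F_of f has_real_derivative D) (at u) \<and> 0 < D"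
      using deriv[of u] pos[of u] that by (intro exI[of _ "1 / f u"]) auto
  qed
  have ex: "\<exists>v>1. F_of f v = s" if "s > 0" for s
  proof -
    have "\<forall>\<^sub>F b in at_top. F_of f b \<ge> s"
      using lim by (simp add: filterlim_at_top)
    then have "\<forall>\<^sub>F b in at_top. F_of f b \<ge> s \<and> b \<ge> 1"
      using eventually_ge_at_top by (rule eventually_conj)
    then obtain b where b: "F_of f b \<ge> s" "b \<ge> 1"
      using eventually_happens'[OF trivial_limit_at_top_linorder] by blast
    have "continuous_on {1..b} (F_of f)"
      unfolding F_of_def[abs_def]
      by (intro indefinite_integral_continuous_1 integrable_continuous_real
          recip_continuous_on[OF cont pos])
    then obtain v where v: "1 \<le> v" "v \<le> b" "F_of f v = s"
      using IVT'[of "F_of f" 1 s b] F1 b \<open>s > 0\<close> by auto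
    with F1 \<open>s > 0\<close> have "v \<noteq> 1" by auto
    with v show ?thesis by (intro exI[of _ v]) auto
  qed
  define G where "G s = (SOME v. v > 1 \<and> F_of f v = s)" for s
  have G: "G s > 1" "F_of f (G s) = s" if "s > 0" for s
    using someI_ex[OF ex[OF that]] unfolding G_def by auto
  \<comment> \<open>\<open>strict\<close> is available only beyond \<open>1\<close>, so
    \<open>v\<close> is compared with the midpoint of \<open>1\<close> and \<open>v\<close>.\<close>
  have Fpos: "F_of f v > 0" if "v > 1" for v
    using strict[of "(1 + v) / 2" v] F_of_nonneg[of f, OF pos, of "(1 + v) / 2"] that by auto
  have GF: "G (F_of f v) = v" if "v > 1" for v
    using G[OF Fpos[OF that]] strict[of v "G (F_of f v)"] strict[of "G (F_of f v)" v] that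
    by (cases "G (F_of f v)" v rule: linorder_cases) auto
  have "(G has_real_derivative f (G s)) (at s)" if "s > 0" for s
  proof -
    have "isCont G (F_of f (G s))"
    \<comment> \<open>This neighbourhood of \<open>G s\<close> stays to the right of
      \<open>1\<close>, where \<open>F\<close> is continuous and \<open>G\<close> is its left
      inverse.\<close>
    proof (rule isCont_inverse_function2[of "(1 + G s) / 2" "G s" "G s + 1"])
      show "G (F_of f v) = v" if "(1 + G s) / 2 \<le> v" "v \<le> G s + 1" for v
        using GF[of v] that G[OF \<open>s > 0\<close>] by auto
      show "isCont (F_of f) v" if "(1 + G s) / 2 \<le> v" "v \<le> G s + 1" for v
        using DERIV_isCont[OF deriv[of v]] that G[OF \<open>s > 0\<close>] by auto
    qed (use G[OF that] in auto)
    then have "isCont G s"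
      using G[OF that] by simp
    then have "(G has_real_derivative inverse (1 / f (G s))) (at s)"
      using deriv[OF G(1)[OF that]] pos[of "G s"] G(1)[OF that] G(2) that
      by (intro DERIV_inverse_function[where f = "F_of f" and a = 0 and b = "s + 1"]) auto
    then show ?thesis by simp
  qed
  with G that show ?thesis by blast
qed

text \<open>Since \<open>f (K u) \<ge> K f u\<close> for large \<open>u\<close>, the function \<open>F (K v) - F v\<close> is nonincreasing there.\<close>

lemma F_of_dilation_le:
  fixes f :: "real \<Rightarrow> real"
  assumes cont: "continuous_on {0<..} f" and pos: "\<And>u. u > 0 \<Longrightarrow> f u > 0"
    and ratio: "mono_on {a..} (\<lambda>u. f u / u)" and "a > 1" "K \<ge> 1" "v \<ge> a"
  shows "F_of f (K * v) \<le> F_of f v + F_of f (K * a)"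
proof -
  have deriv: "(F_of f has_real_derivative 1 / f v) (at v)" if "v > 1" for v
    by (rule F_of_has_real_derivative[OF cont]) (use pos that in auto)
  have "F_of f (K * v) - F_of f v \<le> F_of f (K * a) - F_of f a"
  proof (rule DERIV_nonpos_imp_nonincreasing[OF \<open>v \<ge> a\<close>])
    fix u assume u: "a \<le> u" "u \<le> v"
    then have "u > 1" using \<open>a > 1\<close> by simp
    have Ku: "u \<le> K * u" using \<open>K \<ge> 1\<close> \<open>u > 1\<close> by simp
    have "1 < K * u" using \<open>u > 1\<close> Ku by (rule less_le_trans)
    then have "((\<lambda>u. F_of f (K * u) - F_of f u) has_real_derivative
        1 / f (K * u) * K - 1 / f u) (at u)"
      using \<open>u > 1\<close>
      by (intro DERIV_diff DERIV_chain2[OF deriv] deriv) (auto intro!: derivative_eq_intros)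
    moreover have "f u / u \<le> f (K * u) / (K * u)"
      using mono_onD[OF ratio, of u "K * u"] u Ku by auto
    then have "K * f u \<le> f (K * u)"
      using \<open>u > 1\<close> \<open>K \<ge> 1\<close> by (simp add: field_simps)
    then have "1 / f (K * u) * K - 1 / f u \<le> 0"
      using pos[of u] pos[of "K * u"] \<open>u > 1\<close> Ku by (simp add: field_simps)
    ultimately show "\<exists>D. ((\<lambda>u. F_of f (K * u) - F_of f u) has_real_derivative D) (at u) \<and> D \<le> 0"
      by blast
  qed
  then show ?thesis
    using F_of_nonneg[of f, OF pos, of a] by auto
qed

section \<open>The primitive \<open>H\<close> and a comparison principle\<close>

lemma H_of_continuous_on:
  assumes "\<And>t. t \<ge> 0 \<Longrightarrow> h integrable_on {0..t}"
  shows "continuous_on {0..b} (H_of h)"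
proof (cases "b \<ge> 0")
  case True
  then show ?thesis
    unfolding H_of_def[abs_def] by (intro indefinite_integral_continuous_1 assms)
qed simp

text \<open>Since \<open>h\<close> may be singular at \<open>0\<close>, the fundamental theorem is
  applied from the base point \<open>t / 2\<close>, and \<open>H\<close> is split there.\<close>

lemma H_of_has_real_derivative:
  assumes cont: "continuous_on {0<..} h" and int: "\<And>t. t \<ge> 0 \<Longrightarrow> h integrable_on {0..t}"
    and "t > 0"
  shows "(H_of h has_real_derivative h t) (at t)"
proof -
  have "((\<lambda>s. integral {t / 2..s} h) has_real_derivative h t) (at t within {t / 2..t + 1})"
    using \<open>t > 0\<close> by (intro integral_has_real_derivative continuous_on_subset[OF cont]) auto
  moreover have "at t within {t / 2..t + 1} = at t"
    by (rule at_within_interior) (use \<open>t > 0\<close> in auto)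
  ultimately have "((\<lambda>s. H_of h (t / 2) + integral {t / 2..s} h) has_real_derivative h t) (at t)"
    by (auto intro!: derivative_eq_intros)
  moreover have "\<forall>\<^sub>F s in nhds t. H_of h (t / 2) + integral {t / 2..s} h = H_of h s"
  proof -
    have "\<forall>\<^sub>F s in nhds t. s \<in> {t / 2<..}"
      by (rule eventually_nhds_in_open) (use \<open>t > 0\<close> in auto)
    then show ?thesis
      by eventually_elim
        (unfold H_of_def, use \<open>t > 0\<close> int in \<open>auto intro!: Henstock_Kurzweil_Integration.integral_combine\<close>)
  qed
  ultimately show ?thesis
    by (rule DERIV_cong_ev[OF refl _ refl, THEN iffD1, rotated])
qed

text \<open>After the last time \<open>s\<close> at which \<open>g\<close> is at or below the line,
  \<open>g\<close> stays above it, so its slope is at most \<open>a\<close>; by the mean value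
  theorem it cannot end above the line. The slope bound is thus required only above the
  line.\<close>

lemma linear_barrier:
  fixes g g' :: "real \<Rightarrow> real"
  assumes deriv: "\<And>t. t \<ge> T \<Longrightarrow> (g has_real_derivative g' t) (at t)"
    and above: "\<And>t. t \<ge> T \<Longrightarrow> g t > a * t + C \<Longrightarrow> g' t \<le> a"
    and init: "g T \<le> a * T + C" and "t \<ge> T"
  shows "g t \<le> a * t + C"
proof (rule ccontr)
  assume exceeds: "\<not> g t \<le> a * t + C"
  define S where "S = {T..t} \<inter> (\<lambda>s. g s - a * s) -` {..C}"
  have "continuous_on {T..t} g"
    using deriv by (intro DERIV_continuous_on[where D = g']) (auto intro: has_field_derivative_at_within)
  then have "closed S"
    unfolding S_def by (intro continuous_closed_preimage continuous_intros) auto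
  then have "compact S"
    by (auto simp: compact_eq_bounded_closed S_def)
  moreover have "T \<in> S"
    using init \<open>t \<ge> T\<close> by (auto simp: S_def)
  ultimately obtain s where s: "s \<in> S" and s_max: "\<And>r. r \<in> S \<Longrightarrow> r \<le> s"
    using compact_attains_sup[of S] by blast
  have st: "T \<le> s" "s < t" "g s \<le> a * s + C"
    using s exceeds by (auto simp: S_def less_le)
  obtain r where r: "s < r" "r < t" "g t - g s = (t - s) * g' r"
    using MVT2[of s t g g'] st deriv by auto
  then have "r \<notin> S" using s_max by force
  then have "g' r \<le> a"
    using r st by (intro above) (auto simp: S_def)
  then have "(t - s) * g' r \<le> (t - s) * a"
    using st by (intro mult_left_mono) auto
  with r st exceeds show False by (simp add: algebra_simps)
qed

section \<open>Bounds for solutions of the forced equation\<close>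

locale forced_equation =
  fixes f h x :: "real \<Rightarrow> real" and \<psi> :: real
  assumes f_cont: "continuous_on {0<..} f"
    and f_pos: "\<And>u. u > 0 \<Longrightarrow> f u > 0"
    and f_mono: "mono_on {0<..} f"
    and h_cont: "continuous_on {0<..} h"
    and h_int: "\<And>t. t \<ge> 0 \<Longrightarrow> h integrable_on {0..t}"
    and H_nonneg: "\<And>t. t \<ge> 0 \<Longrightarrow> H_of h t \<ge> 0"
    and \<psi>_pos: "\<psi> > 0"
    and x_sol: "is_solution f h \<psi> x"
begin

abbreviation "F \<equiv> F_of f"
abbreviation "H \<equiv> H_of h"

definition y :: "real \<Rightarrow> real" where "y t = x t - H t"

lemma x_pos: "t \<ge> 0 \<Longrightarrow> x t > 0"
  using x_sol by (simp add: is_solution_def)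

lemma F_mono: "v \<le> w \<Longrightarrow> F v \<le> F w"
  using F_of_mono f_cont f_pos by blast

lemma y_deriv: "t > 0 \<Longrightarrow> (y has_real_derivative f (x t)) (at t)"
  unfolding y_def[abs_def] using x_sol H_of_has_real_derivative[OF h_cont h_int]
  by (auto simp: is_solution_def intro!: derivative_eq_intros)

text \<open>The equation holds only for positive times, but the mean value theorem asks for mere
  continuity at the left endpoint, so \<open>s = 0\<close> is allowed.\<close>

lemma y_mvt:
  assumes "0 \<le> s" "s < t"
  obtains r where "s < r" "r < t" "y t - y s = (t - s) * f (x r)"
proof -
  have "continuous_on {s..t} y"
    unfolding y_def[abs_def] using x_sol assms
    by (intro continuous_intros continuous_on_subset[OF H_of_continuous_on[of h t, OF h_int]])
      (auto simp: is_solution_def elim: continuous_on_subset)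
  then obtain r where "s < r" "r < t" "y t - y s = f (x r) * (t - s)"
    using mvt[of s t y "\<lambda>r. (*) (f (x r))"] y_deriv assms
    by (metis has_field_derivative_def le_less_trans)
  with that show ?thesis by (simp add: mult.commute)
qed

lemma y_ge_init: "t \<ge> 0 \<Longrightarrow> y t \<ge> \<psi>"
proof (cases "t = 0")
  case True
  then show ?thesis using x_sol by (simp add: y_def H_of_def is_solution_def)
next
  case False
  assume "t \<ge> 0"
  with False obtain r where r: "0 < r" "y t - y 0 = (t - 0) * f (x r)"
    using y_mvt[of 0 t] by auto
  then have "y t - y 0 \<ge> 0"
    using f_pos x_pos[of r] \<open>t \<ge> 0\<close> by (simp add: less_imp_le)
  moreover have "y 0 = \<psi>" using x_sol by (simp add: y_def H_of_def is_solution_def)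
  ultimately show ?thesis by simp
qed

lemma y_le_x: "t \<ge> 0 \<Longrightarrow> y t \<le> x t"
  using H_nonneg by (simp add: y_def)

text \<open>From \<open>x \<ge> y \<ge> \<psi>\<close> and monotonicity,
  \<open>y' = f x \<ge> f \<psi>\<close>. This carries \<open>y\<close> past \<open>1\<close>, into
  the region where \<open>F\<close> is differentiable.\<close>

lemma y_ge_linear: "t \<ge> 0 \<Longrightarrow> y t \<ge> f \<psi> * t"
proof (cases "t = 0")
  case True
  then show ?thesis using y_ge_init[of 0] \<psi>_pos by simp
next
  case False
  assume "t \<ge> 0"
  with False obtain r where r: "0 < r" "y t - y 0 = (t - 0) * f (x r)"
    using y_mvt[of 0 t] by auto
  have "f \<psi> \<le> f (x r)"
    using mono_onD[OF f_mono, of \<psi> "x r"] y_ge_init[of r] y_le_x[of r] r \<psi>_pos by auto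
  then have "t * f \<psi> \<le> t * f (x r)"
    using \<open>t \<ge> 0\<close> by (rule mult_left_mono)
  then show ?thesis using r y_ge_init[of 0] \<psi>_pos by (simp add: algebra_simps)
qed

lemma y_eventually_gt:
  obtains T where "T > 0" "\<And>t. t \<ge> T \<Longrightarrow> y t > 1"
proof
  show "2 / f \<psi> > 0" using f_pos \<psi>_pos by simp
  show "y t > 1" if "t \<ge> 2 / f \<psi>" for t
  proof -
    have "2 \<le> f \<psi> * t" "t > 0"
      using that f_pos[OF \<psi>_pos] by (auto simp: field_simps intro: less_le_trans[of 0 "2 / f \<psi>"])
    then show ?thesis using y_ge_linear[of t] by simp
  qed
qed

text \<open>\<open>F y - t\<close> has derivative \<open>f x / f y - 1 \<ge> 0\<close>. The starting
  value \<open>F (y T) \<ge> 0\<close> is dropped, which leaves the constant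
  \<open>T\<close>.\<close>

lemma F_x_lower_bound:
  obtains T where "T > 0" "\<And>t. t \<ge> T \<Longrightarrow> F (x t) \<ge> t - T"
proof -
  obtain T where T: "T > 0" "\<And>t. t \<ge> T \<Longrightarrow> y t > 1"
    using y_eventually_gt by blast
  have "F (x t) \<ge> t - T" if "t \<ge> T" for t
  proof -
    have "F (y T) - T \<le> F (y t) - t"
    proof (rule DERIV_nonneg_imp_nondecreasing[OF that])
      fix s assume s: "T \<le> s" "s \<le> t"
      have "((\<lambda>s. F (y s) - s) has_real_derivative 1 / f (y s) * f (x s) - 1) (at s)"
        using T s by (intro DERIV_diff DERIV_ident
            DERIV_chain2[OF F_of_has_real_derivative[OF f_cont f_pos] y_deriv]) auto
      moreover have "f (y s) \<le> f (x s)"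
        using mono_onD[OF f_mono, of "y s" "x s"] T(2)[of s] s T(1) y_le_x[of s] by auto
      then have "1 / f (y s) * f (x s) - 1 \<ge> 0"
        using f_pos[of "y s"] T(2)[of s] s by (simp add: field_simps)
      ultimately show "\<exists>D. ((\<lambda>s. F (y s) - s) has_real_derivative D) (at s) \<and> 0 \<le> D"
        by blast
    qed
    moreover have "F (y t) \<le> F (x t)"
      using T that by (intro F_mono y_le_x) auto
    ultimately show ?thesis
      using F_of_nonneg[of f, OF f_pos, of "y T"] by auto
  qed
  with T that show ?thesis by blast
qed

text \<open>\<open>linear_barrier\<close> is applied to \<open>F w\<close> with slope
  \<open>1 + \<epsilon>\<close>; the constant \<open>C\<close> is chosen so that above the line only
  the case \<open>w > K z\<close> can occur.\<close>

lemma F_x_upper_bound: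
  assumes F_lim: "filterlim F at_top at_top" and ratio: "mono_on {a..} (\<lambda>u. f u / u)" "a > 1"
    and "\<epsilon> > 0" and H_bound: "\<forall>\<^sub>F t in at_top. F (H t) \<le> (1 + \<epsilon>) * t"
  obtains C where "\<forall>\<^sub>F t in at_top. F (x t) \<le> (1 + \<epsilon>) * t + C"
proof -
  obtain G where G: "\<And>s. s > 0 \<Longrightarrow> G s > 1" "\<And>s. s > 0 \<Longrightarrow> F (G s) = s"
      "\<And>s. s > 0 \<Longrightarrow> (G has_real_derivative f (G s)) (at s)"
    using F_of_inverse_exists[OF f_cont f_pos F_lim] by blast
  define z where "z t = G ((1 + \<epsilon>) * t)" for t
  define w where "w t = y t + z t" for t
  \<comment> \<open>This value makes the contribution of \<open>z\<close> to the derivative of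
    \<open>F w\<close> at most \<open>(1 + \<epsilon>) / K = \<epsilon>\<close>.\<close>
  define K where "K = (1 + \<epsilon>) / \<epsilon>"
  have K: "K \<ge> 1" "(1 + \<epsilon>) / K = \<epsilon>"
    using \<open>\<epsilon> > 0\<close> by (auto simp: K_def field_simps)
  obtain T0 where T0: "\<And>t. t \<ge> T0 \<Longrightarrow> F (H t) \<le> (1 + \<epsilon>) * t"
    using H_bound by (auto simp: eventually_at_top_linorder)
  \<comment> \<open>Past \<open>T0\<close> the bound on \<open>F H\<close> holds, past
    \<open>1\<close> the argument of \<open>G\<close> is positive, and past \<open>F a + 1\<close>
    one has \<open>F z > F a\<close>, hence \<open>z \<ge> a\<close>.\<close>
  define T where "T = max (max T0 1) (F a + 1)"
  have F_z: "F (z t) = (1 + \<epsilon>) * t" if "t \<ge> T" for t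
    using that \<open>\<epsilon> > 0\<close> G by (auto simp: z_def T_def)
  have T_pos: "T > 0" by (auto simp: T_def)
  have z_deriv: "(z has_real_derivative f (z t) * (1 + \<epsilon>)) (at t)" if "t \<ge> T" for t
    unfolding z_def[abs_def] using that \<open>\<epsilon> > 0\<close> T_pos
    by (intro DERIV_chain2[OF G(3)]) (auto intro!: derivative_eq_intros)
  have z_ge: "z t \<ge> a" if "t \<ge> T" for t
  proof (rule ccontr)
    assume "\<not> z t \<ge> a"
    then have "(1 + \<epsilon>) * t \<le> F a" using F_mono[of "z t" a] F_z[OF that] by simp
    moreover have "t \<le> (1 + \<epsilon>) * t"
      using \<open>\<epsilon> > 0\<close> that T_pos by (simp add: algebra_simps)
    ultimately show False using that by (auto simp: T_def)
  qed
  have strict: "v < u" if "F v < F u" for u v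
    using F_mono[of u v] that by force
  have H_le_z: "H t \<le> z t" if "t \<ge> T" for t
  proof (rule ccontr)
    assume "\<not> H t \<le> z t"
    then have less: "z t < H t" by simp
    \<comment> \<open>Monotonicity alone would allow equality; strictness comes from
      \<open>z t \<ge> a > 1\<close>, where \<open>F' = 1 / f\<close> is positive.\<close>
    have "F (z t) < F (H t)"
    proof (rule DERIV_pos_imp_increasing[OF less])
      fix u assume "z t \<le> u" "u \<le> H t"
      then show "\<exists>D. (F has_real_derivative D) (at u) \<and> 0 < D"
        using F_of_has_real_derivative[OF f_cont f_pos, of u] f_pos[of u] z_ge[OF that] \<open>a > 1\<close>
        by (intro exI[of _ "1 / f u"]) auto
    qed
    then show False using T0[of t] F_z[OF that] that by (auto simp: T_def)
  qed
  have w_ge: "z t \<le> w t" "y t \<le> w t" "x t \<le> w t" if "t \<ge> T" for t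
    using H_le_z[OF that] y_ge_init[of t] z_ge[OF that] that T_pos \<psi>_pos \<open>a > 1\<close>
    by (auto simp: w_def y_def)
  \<comment> \<open>The first entry keeps \<open>F (K z)\<close> at or below the line by the
    dilation estimate; the second puts \<open>F w\<close> at or below it at time
    \<open>T\<close>.\<close>
  define C where "C = max (F (K * a)) (F (w T) - (1 + \<epsilon>) * T)"
  have "F (w t) \<le> (1 + \<epsilon>) * t + C" if "t \<ge> T" for t
  proof (rule linear_barrier[OF _ _ _ that])
    fix t assume t: "t \<ge> T"
    have w_gt: "w t > 1" "w t > 0" using w_ge[OF t] z_ge[OF t] \<open>a > 1\<close> by auto
    show "((\<lambda>t. F (w t)) has_real_derivative 1 / f (w t) * (f (x t) + f (z t) * (1 + \<epsilon>))) (at t)"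
      unfolding w_def[abs_def] using w_gt t T_pos
      by (intro DERIV_chain2[OF F_of_has_real_derivative[OF f_cont f_pos]] DERIV_add y_deriv z_deriv)
        (auto simp: w_def)
    assume above: "F (w t) > (1 + \<epsilon>) * t + C"
    have "F (K * z t) \<le> (1 + \<epsilon>) * t + C"
      using F_of_dilation_le[OF f_cont f_pos ratio K(1) z_ge[OF t]] F_z[OF t]
      by (auto simp: C_def)
    then have "K * z t < w t" using above strict[of "K * z t" "w t"] by simp
    then have "z t / w t \<le> 1 / K"
      using w_gt K(1) by (simp add: field_simps)
    moreover have "f (z t) / z t \<le> f (w t) / w t"
      using mono_onD[OF ratio(1), of "z t" "w t"] z_ge[OF t] w_ge(1)[OF t] by auto
    \<comment> \<open>Superlinearity enters here: being smaller than \<open>w\<close> by the factor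
      \<open>K\<close> makes \<open>f z\<close> smaller than \<open>f w\<close> by at least that
      factor.\<close>
    then have "f (z t) / f (w t) \<le> z t / w t"
      using w_gt z_ge[OF t] \<open>a > 1\<close> f_pos[of "w t"] by (simp add: field_simps)
    ultimately have "f (z t) / f (w t) * (1 + \<epsilon>) \<le> 1 / K * (1 + \<epsilon>)"
      using \<open>\<epsilon> > 0\<close> by (intro mult_right_mono) auto
    moreover have "f (x t) / f (w t) \<le> 1"
      using mono_onD[OF f_mono, of "x t" "w t"] w_ge(3)[OF t] x_pos[of t] t T_pos w_gt f_pos[of "w t"]
      by auto
    ultimately show "1 / f (w t) * (f (x t) + f (z t) * (1 + \<epsilon>)) \<le> 1 + \<epsilon>"
      using K(2) by (simp add: add_divide_distrib distrib_left)
  qed (simp add: C_def)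
  then have "F (x t) \<le> (1 + \<epsilon>) * t + C" if "t \<ge> T" for t
    using F_mono[OF w_ge(3)[OF that]] that by force
  then show ?thesis
    using that eventually_at_top_linorder by blast
qed

end

section \<open>The equivalence of the two growth conditions\<close>

theorem theorem2:
  fixes f h x :: "real \<Rightarrow> real" and \<psi> :: real
  assumes f_cont: "continuous_on {0<..} f"
    and f_pos: "\<And>u. u > 0 \<Longrightarrow> f u > 0"
    and f_mono: "mono_on {0<..} f"
    and f_lip: "local_lipschitz (UNIV :: real set) {0<..} (\<lambda>_. f)"
    and f_ratio_mono: "ultimately_increasing (\<lambda>u. f u / u)"
    and f_ratio_lim: "filterlim (\<lambda>u. f u / u) at_top at_top"
    and F_lim: "filterlim (F_of f) at_top at_top"
    and h_cont: "continuous_on {0<..} h"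
    and h_int: "\<And>t. t \<ge> 0 \<Longrightarrow> h integrable_on {0..t}"
    and H_nonneg: "\<And>t. t \<ge> 0 \<Longrightarrow> H_of h t \<ge> 0"
    and \<psi>_pos: "\<psi> > 0"
    and x_sol: "is_solution f h \<psi> x"
  shows "Limsup at_top (\<lambda>t. ereal (F_of f (H_of h t) / t)) \<in> {0..1}
     \<longleftrightarrow> ((\<lambda>t. F_of f (x t) / t) \<longlongrightarrow> 1) at_top"
proof -
  interpret forced_equation f h x \<psi>
    by (rule forced_equation.intro[OF f_cont _ f_mono h_cont _ _ \<psi>_pos x_sol])
      (use f_pos h_int H_nonneg in auto)
  show ?thesis
  proof
    assume "Limsup at_top (\<lambda>t. ereal (F (H t) / t)) \<in> {0..1}"
    then have limsup: "Limsup at_top (\<lambda>t. ereal (F (H t) / t)) \<le> 1" by simp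
    obtain x0 where x0: "mono_on {x0..} (\<lambda>u. f u / u)"
      using f_ratio_mono by (auto simp: ultimately_increasing_def)
    \<comment> \<open>Any threshold above \<open>1\<close> would serve in place of \<open>2\<close>;
      it keeps \<open>a\<close> where \<open>F\<close> is differentiable.\<close>
    define a where "a = max x0 2"
    have ratio: "mono_on {a..} (\<lambda>u. f u / u)" "a > 1"
      by (auto simp: a_def intro: mono_on_subset[OF x0])
    show "((\<lambda>t. F (x t) / t) \<longlongrightarrow> 1) at_top"
    proof (rule order_tendstoI)
      fix c :: real assume "c < 1"
      obtain T where T: "\<And>t. t \<ge> T \<Longrightarrow> F (x t) \<ge> t - T"
        using F_x_lower_bound by blast
      have "((\<lambda>t. 1 - T / t) \<longlongrightarrow> 1 - 0) at_top"
        by (intro tendsto_intros real_tendsto_divide_at_top[OF tendsto_const] filterlim_ident)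
      then have "\<forall>\<^sub>F t in at_top. c < 1 - T / t"
        using \<open>c < 1\<close> by (auto dest: order_tendstoD)
      then show "\<forall>\<^sub>F t in at_top. c < F (x t) / t"
        using eventually_ge_at_top[of T] eventually_gt_at_top[of 0]
      proof eventually_elim
        case (elim t)
        then have "(t - T) / t \<le> F (x t) / t"
          using T[of t] by (intro divide_right_mono) auto
        then have "1 - T / t \<le> F (x t) / t"
          using elim by (simp add: diff_divide_distrib)
        with elim show ?case by simp
      qed
    next
      fix c :: real assume "c > 1"
      \<comment> \<open>Half of the gap between \<open>1\<close> and \<open>c\<close> is kept in
        reserve to absorb the vanishing term \<open>C / t\<close>.\<close>
      define \<epsilon> where "\<epsilon> = (c - 1) / 2"
      have \<epsilon>: "\<epsilon> > 0" "1 + \<epsilon> < c" using \<open>c > 1\<close> by (auto simp: \<epsilon>_def field_simps)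
      have "Limsup at_top (\<lambda>t. ereal (F (H t) / t)) < ereal (1 + \<epsilon>)"
        using le_less_trans[OF limsup, of "ereal (1 + \<epsilon>)"] \<epsilon> by simp
      then have "\<forall>\<^sub>F t in at_top. ereal (F (H t) / t) < ereal (1 + \<epsilon>)"
        by (rule Limsup_lessD)
      then have "\<forall>\<^sub>F t in at_top. F (H t) \<le> (1 + \<epsilon>) * t"
        using eventually_gt_at_top[of 0] by eventually_elim (simp add: field_simps)
      then obtain C where C: "\<forall>\<^sub>F t in at_top. F (x t) \<le> (1 + \<epsilon>) * t + C"
        using F_x_upper_bound[OF F_lim ratio \<epsilon>(1)] by blast
      have "((\<lambda>t. (1 + \<epsilon>) + C / t) \<longlongrightarrow> (1 + \<epsilon>) + 0) at_top"
        by (intro tendsto_intros real_tendsto_divide_at_top[OF tendsto_const] filterlim_ident)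
      then have "\<forall>\<^sub>F t in at_top. (1 + \<epsilon>) + C / t < c"
        using \<epsilon> by (auto dest: order_tendstoD)
      then show "\<forall>\<^sub>F t in at_top. F (x t) / t < c"
        using C eventually_gt_at_top[of 0]
      proof eventually_elim
        case (elim t)
        then have "F (x t) / t \<le> ((1 + \<epsilon>) * t + C) / t"
          by (intro divide_right_mono) auto
        then have "F (x t) / t \<le> (1 + \<epsilon>) + C / t"
          using elim by (simp add: add_divide_distrib)
        with elim show ?case by simp
      qed
    qed
  next
    assume lim: "((\<lambda>t. F (x t) / t) \<longlongrightarrow> 1) at_top"
    have "Limsup at_top (\<lambda>t. ereal (F (H t) / t)) \<le> Limsup at_top (\<lambda>t. ereal (F (x t) / t))"
    proof (rule Limsup_mono)
      show "\<forall>\<^sub>F t in at_top. ereal (F (H t) / t) \<le> ereal (F (x t) / t)"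
        using eventually_gt_at_top[of 0]
      proof eventually_elim
        case (elim t)
        \<comment> \<open>\<open>H \<le> x\<close> because
          \<open>x - H = y \<ge> \<psi> > 0\<close>.\<close>
        then have "F (H t) \<le> F (x t)"
          using y_ge_init[of t] \<psi>_pos by (intro F_mono) (simp add: y_def)
        with elim show ?case by (simp add: divide_right_mono)
      qed
    qed
    also have "\<dots> = ereal 1"
      by (rule lim_imp_Limsup) (use lim in auto)
    finally have "Limsup at_top (\<lambda>t. ereal (F (H t) / t)) \<le> 1"
      by (simp only: one_ereal_def)
    moreover have "0 \<le> Limsup at_top (\<lambda>t. ereal (F (H t) / t))"
    proof (rule le_Limsup)
      show "\<forall>\<^sub>F t in at_top. 0 \<le> ereal (F (H t) / t)"
        using eventually_gt_at_top[of 0]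
        by eventually_elim (use F_of_nonneg[of f, OF f_pos] in auto)
    qed simp
    ultimately show "Limsup at_top (\<lambda>t. ereal (F (H t) / t)) \<in> {0..1}" by simp
  qed
qed

end
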